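(* Let $n=2m$ with $m$ a positive integer, and let $(a_{ij}),(b_{jh}),(d_{hi})$, $0\le i,j,h\le n-1$, be three $n\times n$ matrices of indeterminates, with indices extended by the convention $f_{ln}=f_{l0}$ and $f_{nl}=f_{0l}$ for $l=0,1,\dots,n$, where $f$ stands for $a$, $b$, $d$. Then the following identity in $a_{ij},b_{jh},d_{hi}$ holds: $$\sum_{\substack{0\le i,j,h\le n-1\\ i+j+h\ \mathrm{even}}}(a_{ij}+a_{h+1,i+1})(b_{jh}+b_{i+1,j+1})(d_{hi}+d_{j+1,h+1})$$ $$-\sum_{i,h=0}^{n-1}a_{h+1,i+1}\Big(\sum_{\substack{0\le j\le n-1\\ i+j+h\ \mathrm{even}}}(b_{jh}+b_{i+1,j+1})\Big)d_{hi}$$ $$-\sum_{i,j=0}^{n-1}a_{ij}\,b_{i+1,j+1}\Big(\sum_{\substack{0\le h\le n-1\\ i+j+h\ \mathrm{even}}}(d_{hi}+d_{j+1,h+1})\Big)$$ $$-\sum_{h,j=0}^{n-1}\Big(\sum_{\substack{0\le i\le n-1\\ i+j+h\ \mathrm{even}}}(a_{ij}+a_{h+1,i+1})\Big)b_{jh}\,d_{j+1,h+1}\ \equiv\ \sum_{i,j,h=0}^{n-1}a_{ij}\,b_{jh}\,d_{hi},$$ and it defines an elementary program for multiplying two $n\times n$ matrices of length $R_{nnn}=0.5\,n^3+3n^2$.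
   Context: An elementary program of length $R$ for multiplying two $n\times n$ matrices $(a_{ij})$ and $(b_{gh})$ consists of numbers $u_{ij}^{(s)},v_{gh}^{(s)},w_{lq}^{(s)}$ (all subscripts in $\{0,\dots,n-1\}$, $s=1,\dots,R$) such that, identically in the $a_{ij}$ and $b_{gh}$, $$\sum_{g=0}^{n-1}a_{lg}b_{gq}\equiv\sum_{s=1}^{R}w_{lq}^{(s)}\Big(\sum_{i,j=0}^{n-1}u_{ij}^{(s)}a_{ij}\Big)\Big(\sum_{g,h=0}^{n-1}v_{gh}^{(s)}b_{gh}\Big)\qquad (0\le l,q\le n-1).$$ A trilinear identity $$\sum_{s=1}^{R}\Big(\sum_{i,j}u_{ij}^{(s)}a_{ij}\Big)\Big(\sum_{g,h}v_{gh}^{(s)}b_{gh}\Big)\Big(\sum_{l,q}w_{lq}^{(s)}d_{ql}\Big)\equiv\sum_{i,j,h}a_{ij}b_{jh}d_{hi}$$ is said to define the elementary program with coefficients $u_{ij}^{(s)},v_{gh}^{(s)},w_{lq}^{(s)}$. *)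

theory Defs
  imports Complex_Main "HOL-Library.Poly_Mapping"
begin

datatype var = VA nat nat | VB nat nat | VD nat nat

text \<open>Polynomials over \<open>'k\<close> in the entries of three matrices, as the monoid algebra of the
  monomials \<open>var \<Rightarrow>\<^sub>0 nat\<close>; an identity \<open>\<equiv>\<close> in the indeterminates is an equation in this ring.\<close>

type_synonym 'k mpoly = "(var \<Rightarrow>\<^sub>0 nat) \<Rightarrow>\<^sub>0 'k"

definition indet :: "var \<Rightarrow> 'k::comm_ring_1 mpoly" where
  "indet x = Poly_Mapping.single (Poly_Mapping.single x 1) 1"

definition scalar :: "'k::comm_ring_1 \<Rightarrow> 'k mpoly" where
  "scalar c = Poly_Mapping.single 0 c"

definition formA :: "nat \<Rightarrow> (nat \<Rightarrow> nat \<Rightarrow> 'k::comm_ring_1) \<Rightarrow> 'k mpoly" where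
  "formA n u = (\<Sum>i<n. \<Sum>j<n. scalar (u i j) * indet (VA i j))"

definition formB :: "nat \<Rightarrow> (nat \<Rightarrow> nat \<Rightarrow> 'k::comm_ring_1) \<Rightarrow> 'k mpoly" where
  "formB n v = (\<Sum>g<n. \<Sum>h<n. scalar (v g h) * indet (VB g h))"

text \<open>Note the transposition: \<open>w l q\<close> is the coefficient of the entry \<open>(q, l)\<close>.\<close>

definition formD :: "nat \<Rightarrow> (nat \<Rightarrow> nat \<Rightarrow> 'k::comm_ring_1) \<Rightarrow> 'k mpoly" where
  "formD n w = (\<Sum>l<n. \<Sum>q<n. scalar (w l q) * indet (VD q l))"

definition elementary_program ::
  "nat \<Rightarrow> nat \<Rightarrow> (nat \<Rightarrow> nat \<Rightarrow> nat \<Rightarrow> 'k::comm_ring_1) \<Rightarrow> (nat \<Rightarrow> nat \<Rightarrow> nat \<Rightarrow> 'k)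
    \<Rightarrow> (nat \<Rightarrow> nat \<Rightarrow> nat \<Rightarrow> 'k) \<Rightarrow> bool" where
  "elementary_program n R u v w \<longleftrightarrow>
    (\<forall>l<n. \<forall>q<n. (\<Sum>g<n. indet (VA l g) * indet (VB g q) :: 'k mpoly) =
      (\<Sum>s=1..R. scalar (w s l q) * formA n (u s) * formB n (v s)))"

definition trilinear_identity ::
  "nat \<Rightarrow> nat \<Rightarrow> (nat \<Rightarrow> nat \<Rightarrow> nat \<Rightarrow> 'k::comm_ring_1) \<Rightarrow> (nat \<Rightarrow> nat \<Rightarrow> nat \<Rightarrow> 'k)
    \<Rightarrow> (nat \<Rightarrow> nat \<Rightarrow> nat \<Rightarrow> 'k) \<Rightarrow> bool" where
  "trilinear_identity n R u v w \<longleftrightarrow>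
    (\<Sum>s=1..R. formA n (u s) * formB n (v s) * formD n (w s)) =
    (\<Sum>i<n. \<Sum>j<n. \<Sum>h<n. indet (VA i j) * indet (VB j h) * indet (VD h i) :: 'k mpoly)"

text \<open>A left-hand side of a trilinear identity is given by the list \<open>ts\<close> of its summands, each a
  triple of factors. It defines the program whose \<open>s\<close>-th multiplication (counted from 1) has
  the coefficients of the factors of the \<open>s\<close>-th summand.\<close>

definition defines_program ::
  "nat \<Rightarrow> ('k::comm_ring_1 mpoly \<times> 'k mpoly \<times> 'k mpoly) list \<Rightarrow> nat
    \<Rightarrow> (nat \<Rightarrow> nat \<Rightarrow> nat \<Rightarrow> 'k) \<Rightarrow> (nat \<Rightarrow> nat \<Rightarrow> nat \<Rightarrow> 'k) \<Rightarrow> (nat \<Rightarrow> nat \<Rightarrow> nat \<Rightarrow> 'k) \<Rightarrow> bool" where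
  "defines_program n ts R u v w \<longleftrightarrow>
    R = length ts \<and>
    (\<forall>s\<in>{1..R}. ts ! (s - 1) = (formA n (u s), formB n (v s), formD n (w s))) \<and>
    trilinear_identity n R u v w \<and>
    elementary_program n R u v w"

text \<open>The matrix of indeterminates \<open>X i j\<close>, with index \<open>n\<close> identified with \<open>0\<close>.\<close>

definition extended_indets ::
  "nat \<Rightarrow> (nat \<Rightarrow> nat \<Rightarrow> var) \<Rightarrow> (nat \<Rightarrow> nat \<Rightarrow> 'k::comm_ring_1 mpoly) \<Rightarrow> bool" where
  "extended_indets n X f \<longleftrightarrow>
    (\<forall>i<n. \<forall>j<n. f i j = indet (X i j)) \<and> (\<forall>l\<le>n. f l n = f l 0 \<and> f n l = f 0 l)"

text \<open>The summands of the aggregation identity: the aggregated products, followed by the three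
  families of corrections, whose minus sign is attached to the first factor.\<close>

definition aggregation_terms ::
  "nat \<Rightarrow> (nat \<Rightarrow> nat \<Rightarrow> 'k::comm_ring_1 mpoly) \<Rightarrow> (nat \<Rightarrow> nat \<Rightarrow> 'k mpoly) \<Rightarrow> (nat \<Rightarrow> nat \<Rightarrow> 'k mpoly)
    \<Rightarrow> ('k mpoly \<times> 'k mpoly \<times> 'k mpoly) list" where
  "aggregation_terms n a b d =
     [(a i j + a (h+1) (i+1), b j h + b (i+1) (j+1), d h i + d (j+1) (h+1)).
        i \<leftarrow> [0..<n], j \<leftarrow> [0..<n], h \<leftarrow> [0..<n], even (i + j + h)] @
     [(- a (h+1) (i+1), \<Sum>j | j < n \<and> even (i + j + h). b j h + b (i+1) (j+1), d h i).
        i \<leftarrow> [0..<n], h \<leftarrow> [0..<n]] @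
     [(- a i j, b (i+1) (j+1), \<Sum>h | h < n \<and> even (i + j + h). d h i + d (j+1) (h+1)).
        i \<leftarrow> [0..<n], j \<leftarrow> [0..<n]] @
     [(- (\<Sum>i | i < n \<and> even (i + j + h). a i j + a (h+1) (i+1)), b j h, d (j+1) (h+1)).
        h \<leftarrow> [0..<n], j \<leftarrow> [0..<n]]"

end

theory Submission
  imports Defs
begin

text \<open>Of the eight products in the expansion of an aggregated term, the three families of
  corrections cancel the six mixed ones. Since \<open>n\<close> is even, the cyclic shift
  \<open>(i, j, h) \<mapsto> (h + 1, i + 1, j + 1)\<close> modulo \<open>n\<close> maps the triples of even sum
  bijectively to those of odd sum, so the two unmixed products supply the even and the odd half
  of the trace of the product. The program is read off by comparing, on both sides of the
  trilinear identity, the coefficients of the entries of the third matrix.\<close>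

subsection \<open>Even and odd triples\<close>

definition even_triples :: "nat \<Rightarrow> (nat \<times> nat \<times> nat) set" where
  "even_triples n = {(i, j, h). i < n \<and> j < n \<and> h < n \<and> even (i + j + h)}"

definition odd_triples :: "nat \<Rightarrow> (nat \<times> nat \<times> nat) set" where
  "odd_triples n = {(i, j, h). i < n \<and> j < n \<and> h < n \<and> odd (i + j + h)}"

text \<open>Successor modulo \<open>n\<close> on the indices below \<open>n\<close>. The case
  distinction instead of \<open>mod\<close> mirrors the convention that identifies index
  \<open>n\<close> with \<open>0\<close>.\<close>

definition cyc_Suc :: "nat \<Rightarrow> nat \<Rightarrow> nat" where
  "cyc_Suc n i = (if Suc i = n then 0 else Suc i)"

definition cyc_pred :: "nat \<Rightarrow> nat \<Rightarrow> nat" where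
  "cyc_pred n i = (if i = 0 then n - 1 else i - 1)"

lemma cyc_pred_cyc_Suc: "i < n \<Longrightarrow> cyc_pred n (cyc_Suc n i) = i"
  by (auto simp: cyc_pred_def cyc_Suc_def)

lemma cyc_Suc_cyc_pred: "i < n \<Longrightarrow> cyc_Suc n (cyc_pred n i) = i"
  by (auto simp: cyc_pred_def cyc_Suc_def)

lemma cyc_Suc_less: "i < n \<Longrightarrow> cyc_Suc n i < n"
  by (auto simp: cyc_Suc_def)

lemma cyc_pred_less: "i < n \<Longrightarrow> cyc_pred n i < n"
  by (auto simp: cyc_pred_def)

text \<open>Wrapping around respects the change of parity: the last index \<open>n - 1\<close> is
  odd because \<open>n\<close> is even, and it goes to the even index \<open>0\<close>.\<close>

lemma even_cyc_Suc: "even n \<Longrightarrow> i < n \<Longrightarrow> even (cyc_Suc n i) \<longleftrightarrow> odd i"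
  by (auto simp: cyc_Suc_def)

lemma even_cyc_pred: "even n \<Longrightarrow> i < n \<Longrightarrow> even (cyc_pred n i) \<longleftrightarrow> odd i"
  by (metis cyc_Suc_cyc_pred cyc_pred_less even_cyc_Suc)

text \<open>Filling the excluded triples with \<open>0\<close> makes the three ranges independent,
  so that summations can be exchanged.\<close>

lemma sum_triples:
  fixes f :: "nat \<Rightarrow> nat \<Rightarrow> nat \<Rightarrow> 'a::comm_monoid_add"
  shows "(\<Sum>(i, j, h) | i < n \<and> j < n \<and> h < n \<and> P i j h. f i j h) =
    (\<Sum>i<n. \<Sum>j<n. \<Sum>h<n. if P i j h then f i j h else 0)"
proof -
  have "(\<Sum>(i, j, h) | i < n \<and> j < n \<and> h < n \<and> P i j h. f i j h) =
    (\<Sum>(i, j, h)\<in>{..<n} \<times> {..<n} \<times> {..<n}. if P i j h then f i j h else 0)"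
    by (rule sum.mono_neutral_cong_left) (auto split: if_splits)
  then show ?thesis
    by (simp add: sum.cartesian_product)
qed

lemma sum_triples_add_complement:
  fixes f :: "nat \<Rightarrow> nat \<Rightarrow> nat \<Rightarrow> 'a::comm_monoid_add"
  shows "(\<Sum>(i, j, h) | i < n \<and> j < n \<and> h < n \<and> P i j h. f i j h) +
      (\<Sum>(i, j, h) | i < n \<and> j < n \<and> h < n \<and> \<not> P i j h. f i j h) =
    (\<Sum>i<n. \<Sum>j<n. \<Sum>h<n. f i j h)"
  unfolding sum_triples sum.distrib[symmetric] by (intro sum.cong) auto

lemmas sum_even_triples = sum_triples[where P = "\<lambda>i j h. even (i + j + h)", folded even_triples_def]

text \<open>All three coordinates change parity under the shift, hence so does their sum.\<close>

lemma sum_even_triples_shift: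
  fixes f :: "nat \<Rightarrow> nat \<Rightarrow> nat \<Rightarrow> 'a::comm_monoid_add"
  assumes "even n"
  shows "(\<Sum>(i, j, h)\<in>even_triples n. f (cyc_Suc n h) (cyc_Suc n i) (cyc_Suc n j)) =
    (\<Sum>(i, j, h)\<in>odd_triples n. f i j h)"
  by (rule sum.reindex_bij_witness
      \<comment> \<open>The second map goes from even to odd triples; the first is its inverse,
        which steps each coordinate back and undoes the rotation.\<close>
      [where i = "\<lambda>(i, j, h). (cyc_pred n j, cyc_pred n h, cyc_pred n i)"
         and j = "\<lambda>(i, j, h). (cyc_Suc n h, cyc_Suc n i, cyc_Suc n j)"])
    (use assms in \<open>auto simp: even_triples_def odd_triples_def cyc_pred_cyc_Suc cyc_Suc_cyc_pred
       cyc_Suc_less cyc_pred_less even_cyc_Suc even_cyc_pred\<close>)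

lemma sum_even_triples_add_shift:
  fixes f :: "nat \<Rightarrow> nat \<Rightarrow> nat \<Rightarrow> 'a::comm_monoid_add"
  assumes "even n"
  shows "(\<Sum>(i, j, h)\<in>even_triples n. f i j h) +
      (\<Sum>(i, j, h)\<in>even_triples n. f (cyc_Suc n h) (cyc_Suc n i) (cyc_Suc n j)) =
    (\<Sum>i<n. \<Sum>j<n. \<Sum>h<n. f i j h)"
  unfolding sum_even_triples_shift[OF assms] unfolding even_triples_def odd_triples_def
  by (rule sum_triples_add_complement)

text \<open>For the constant summand \<open>1\<close> both sums over even triples are the
  cardinality, and the full sum is \<open>n ^ 3\<close>.\<close>

lemma two_card_even_triples: "even n \<Longrightarrow> 2 * card (even_triples n) = n ^ 3"
  using sum_even_triples_add_shift[of n "\<lambda>_ _ _. 1 :: nat"]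
  by (simp add: case_prod_unfold power3_eq_cube)

section \<open>The aggregation identity over a commutative ring\<close>

lemma sum_filter_lessThan:
  fixes f :: "nat \<Rightarrow> 'a::comm_monoid_add"
  shows "(\<Sum>j | j < n \<and> P j. f j) = (\<Sum>j<n. if P j then f j else 0)"
  by (rule sum.mono_neutral_cong_left) auto

text \<open>All that is kept of the index convention is that entries at \<open>(i+1, j+1)\<close>
  are entries at cyclically shifted indices; this suffices in any commutative ring.\<close>

lemma aggregation_identity:
  fixes a b d :: "nat \<Rightarrow> nat \<Rightarrow> 'a::comm_ring_1"
  assumes "even n"
    and a: "\<And>i j. i < n \<Longrightarrow> j < n \<Longrightarrow> a (i+1) (j+1) = a (cyc_Suc n i) (cyc_Suc n j)"
    and b: "\<And>i j. i < n \<Longrightarrow> j < n \<Longrightarrow> b (i+1) (j+1) = b (cyc_Suc n i) (cyc_Suc n j)"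
    and d: "\<And>i j. i < n \<Longrightarrow> j < n \<Longrightarrow> d (i+1) (j+1) = d (cyc_Suc n i) (cyc_Suc n j)"
  shows "(\<Sum>(i, j, h)\<in>even_triples n.
            (a i j + a (h+1) (i+1)) * (b j h + b (i+1) (j+1)) * (d h i + d (j+1) (h+1)))
         - (\<Sum>i<n. \<Sum>h<n. a (h+1) (i+1)
              * (\<Sum>j | j < n \<and> even (i + j + h). b j h + b (i+1) (j+1)) * d h i)
         - (\<Sum>i<n. \<Sum>j<n. a i j * b (i+1) (j+1)
              * (\<Sum>h | h < n \<and> even (i + j + h). d h i + d (j+1) (h+1)))
         - (\<Sum>h<n. \<Sum>j<n. (\<Sum>i | i < n \<and> even (i + j + h). a i j + a (h+1) (i+1))
              * b j h * d (j+1) (h+1))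
         = (\<Sum>i<n. \<Sum>j<n. \<Sum>h<n. a i j * b j h * d h i)"
    (is "?S - ?S1 - ?S2 - ?S3 = ?T")
proof -
  \<comment> \<open>Each correction family becomes a sum over the same even triples once its outer
    factors are multiplied into the inner sum; here \<open>j\<close> and \<open>h\<close> must also
    be exchanged.\<close>
  have S1: "?S1 = (\<Sum>(i, j, h)\<in>even_triples n.
      a (h+1) (i+1) * (b j h + b (i+1) (j+1)) * d h i)"
    unfolding sum_even_triples sum_filter_lessThan sum_distrib_left sum_distrib_right
    by (rule sum.cong[OF refl], subst sum.swap) (intro sum.cong, auto)
  have S2: "?S2 = (\<Sum>(i, j, h)\<in>even_triples n.
      a i j * b (i+1) (j+1) * (d h i + d (j+1) (h+1)))"
    unfolding sum_even_triples sum_filter_lessThan sum_distrib_left sum_distrib_right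
    by (intro sum.cong) auto
  \<comment> \<open>The order \<open>h, j, i\<close> is brought to \<open>j, i, h\<close> and then
    to \<open>i, j, h\<close>.\<close>
  have "?S3 = (\<Sum>h<n. \<Sum>j<n. \<Sum>i<n. if even (i + j + h)
      then (a i j + a (h+1) (i+1)) * b j h * d (j+1) (h+1) else 0)"
    unfolding sum_filter_lessThan sum_distrib_left sum_distrib_right
    by (intro sum.cong) auto
  also have "\<dots> = (\<Sum>j<n. \<Sum>i<n. \<Sum>h<n. if even (i + j + h)
      then (a i j + a (h+1) (i+1)) * b j h * d (j+1) (h+1) else 0)"
    by (subst sum.swap) (intro sum.cong refl sum.swap)
  also have "\<dots> = (\<Sum>(i, j, h)\<in>even_triples n.
      (a i j + a (h+1) (i+1)) * b j h * d (j+1) (h+1))"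
    unfolding sum_even_triples by (rule sum.swap)
  finally have S3: "?S3 = \<dots>" .
  \<comment> \<open>Termwise, with primes for the shifted entries: \<open>(p + p')(q + q')(r + r') -
    p'(q + q')r - pq'(r + r') - (p + p')qr' = pqr + p'q'r'\<close>.\<close>
  have "?S - ?S1 - ?S2 - ?S3 = (\<Sum>(i, j, h)\<in>even_triples n. a i j * b j h * d h i) +
     (\<Sum>(i, j, h)\<in>even_triples n. a (h+1) (i+1) * b (i+1) (j+1) * d (j+1) (h+1))"
    unfolding S1 S2 S3 sum_subtractf[symmetric] sum.distrib[symmetric]
    by (rule sum.cong[OF refl]) (auto simp: algebra_simps)
  \<comment> \<open>The product of shifted entries is the summand
    \<open>a i j * b j h * d h i\<close> evaluated at the shifted triple.\<close>
  also have "(\<Sum>(i, j, h)\<in>even_triples n. a (h+1) (i+1) * b (i+1) (j+1) * d (j+1) (h+1)) =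
     (\<Sum>(i, j, h)\<in>even_triples n. a (cyc_Suc n h) (cyc_Suc n i) * b (cyc_Suc n i) (cyc_Suc n j)
        * d (cyc_Suc n j) (cyc_Suc n h))"
    by (rule sum.cong[OF refl]) (use a b d in \<open>auto simp: even_triples_def\<close>)
  finally show ?thesis
    using sum_even_triples_add_shift[OF assms(1), of "\<lambda>i j h. a i j * b j h * d h i"]
    by simp
qed

subsection \<open>Linear forms\<close>

text \<open>One notion covers \<open>formA\<close>, \<open>formB\<close> and \<open>formD\<close>,
  so that closure properties are proved once for all three matrices.\<close>

definition linear_form :: "nat \<Rightarrow> (nat \<Rightarrow> nat \<Rightarrow> var) \<Rightarrow> 'k::comm_ring_1 mpoly \<Rightarrow> bool" where
  "linear_form n X p \<longleftrightarrow> (\<exists>u. p = (\<Sum>i<n. \<Sum>j<n. scalar (u i j) * indet (X i j)))"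

lemma scalar_add: "scalar (c + c') = scalar c + scalar c'"
  by (simp add: scalar_def single_add)

lemma scalar_uminus: "scalar (- c) = - scalar c"
  by (simp add: scalar_def single_uminus)

lemma scalar_0: "scalar 0 = 0"
  by (simp add: scalar_def)

lemma scalar_1: "scalar 1 = 1"
  by (simp add: scalar_def)

lemma linear_form_add:
  assumes "linear_form n X p" "linear_form n X q"
  shows "linear_form n X (p + q)"
proof -
  from assms obtain u v where
    "p = (\<Sum>i<n. \<Sum>j<n. scalar (u i j) * indet (X i j))"
    "q = (\<Sum>i<n. \<Sum>j<n. scalar (v i j) * indet (X i j))"
    by (auto simp: linear_form_def)
  then have "p + q = (\<Sum>i<n. \<Sum>j<n. scalar (u i j + v i j) * indet (X i j))"
    by (simp add: scalar_add distrib_right sum.distrib)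
  then show ?thesis
    unfolding linear_form_def by (intro exI[of _ "\<lambda>i j. u i j + v i j"])
qed

lemma linear_form_uminus:
  assumes "linear_form n X p"
  shows "linear_form n X (- p)"
proof -
  from assms obtain u where "p = (\<Sum>i<n. \<Sum>j<n. scalar (u i j) * indet (X i j))"
    by (auto simp: linear_form_def)
  then have "- p = (\<Sum>i<n. \<Sum>j<n. scalar (- u i j) * indet (X i j))"
    by (simp add: scalar_uminus sum_negf)
  then show ?thesis
    unfolding linear_form_def by (intro exI[of _ "\<lambda>i j. - u i j"])
qed

lemma linear_form_0: "linear_form n X 0"
  unfolding linear_form_def by (rule exI[of _ "\<lambda>_ _. 0"]) (simp add: scalar_0)

lemma linear_form_sum:
  "(\<And>x. x \<in> A \<Longrightarrow> linear_form n X (f x)) \<Longrightarrow> linear_form n X (sum f A)"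
  by (induction A rule: infinite_finite_induct) (simp_all add: linear_form_0 linear_form_add)

lemma linear_form_indet:
  assumes "i < n" "j < n"
  shows "linear_form n X (indet (X i j))"
proof -
  \<comment> \<open>The coefficients are a Kronecker delta, written with nested conditionals so that
    the two sums collapse one after the other.\<close>
  have "(\<Sum>i'<n. \<Sum>j'<n. scalar (if i' = i then if j' = j then 1 else 0 else 0) * indet (X i' j')) =
    (\<Sum>i'<n. \<Sum>j'<n. if i' = i then if j' = j then indet (X i j) else 0 else 0)"
    by (intro sum.cong refl) (auto simp: scalar_0 scalar_1)
  also have "\<dots> = (\<Sum>i'<n. if i' = i then \<Sum>j'<n. if j' = j then indet (X i j) else 0 else 0)"
    by (intro sum.cong) auto
  also have "\<dots> = indet (X i j)"
    using assms by simp
  finally show ?thesis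
    unfolding linear_form_def
    by (intro exI[of _ "\<lambda>i' j'. if i' = i then if j' = j then 1 else 0 else 0"]) (rule sym)
qed

lemma linear_form_formA: "linear_form n VA p \<longleftrightarrow> (\<exists>u. p = formA n u)"
  by (simp add: linear_form_def formA_def)

lemma linear_form_formB: "linear_form n VB p \<longleftrightarrow> (\<exists>v. p = formB n v)"
  by (simp add: linear_form_def formB_def)

text \<open>The transposition in \<open>formD\<close> is absorbed by transposing the
  coefficients.\<close>

lemma linear_form_formD:
  assumes "linear_form n VD p"
  shows "\<exists>w. p = formD n w"
proof -
  from assms obtain u where "p = (\<Sum>i<n. \<Sum>j<n. scalar (u i j) * indet (VD i j))"
    by (auto simp: linear_form_def)
  then have "p = formD n (\<lambda>l q. u q l)"
    unfolding formD_def by (subst sum.swap) simp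
  then show ?thesis by blast
qed

text \<open>At the corner both halves of the convention apply in turn:
  \<open>f n n = f n 0 = f 0 0\<close>.\<close>

lemma extended_indets_Suc:
  assumes "extended_indets n X f" "i < n" "j < n"
  shows "f (i+1) (j+1) = f (cyc_Suc n i) (cyc_Suc n j)"
  using assms by (auto simp: extended_indets_def cyc_Suc_def)

lemma linear_form_extended_indets:
  assumes "extended_indets n X f" "i \<le> n" "j \<le> n" "n > 0"
  shows "linear_form n X (f i j)"
proof -
  have "f i j = f (if i = n then 0 else i) (if j = n then 0 else j)"
    using assms by (auto simp: extended_indets_def)
  also have "\<dots> = indet (X (if i = n then 0 else i) (if j = n then 0 else j))"
    using assms by (auto simp: extended_indets_def)
  finally show ?thesis
    using assms by (auto intro!: linear_form_indet)
qed

subsection \<open>Reading off the program\<close>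

text \<open>Describes the polynomials in the first two matrices by their support. Coefficients of
  the entries of the third matrix are to be compared within this subring; otherwise a product of two
  such entries could be credited to either one.\<close>

definition D_free :: "'k::comm_ring_1 mpoly \<Rightarrow> bool" where
  "D_free p \<longleftrightarrow> (\<forall>\<mu>\<in>Poly_Mapping.keys p. \<forall>q l. Poly_Mapping.lookup \<mu> (VD q l) = 0)"

lemma D_free_mult: "D_free p \<Longrightarrow> D_free p' \<Longrightarrow> D_free (p * p')"
  using keys_mult[of p p'] by (force simp: D_free_def lookup_add)

lemma D_free_sum: "(\<And>x. x \<in> A \<Longrightarrow> D_free (f x)) \<Longrightarrow> D_free (sum f A)"
  using keys_sum[of f A] by (fastforce simp: D_free_def)

lemma D_free_scalar: "D_free (scalar c)"
  by (simp add: D_free_def scalar_def)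

lemma D_free_indet: "(\<And>q l. x \<noteq> VD q l) \<Longrightarrow> D_free (indet x)"
  by (auto simp: D_free_def indet_def lookup_single)

lemma D_free_formA: "D_free (formA n u)"
  by (simp add: formA_def D_free_sum D_free_mult D_free_scalar D_free_indet)

lemma D_free_formB: "D_free (formB n v)"
  by (simp add: formB_def D_free_sum D_free_mult D_free_scalar D_free_indet)

section \<open>Comparing coefficients of the entries of the third matrix\<close>

lemma lookup_mult_indet:
  fixes p :: "'k::comm_ring_1 mpoly"
  shows "Poly_Mapping.lookup (p * indet x) (\<mu> + Poly_Mapping.single x 1) = Poly_Mapping.lookup p \<mu>"
proof -
  let ?x = "Poly_Mapping.single x (1::nat)"
  \<comment> \<open>In the convolution defining the product, cancellation of exponents leaves only
    the pair of \<mu> and the monomial of \<open>x\<close>.\<close>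
  have "Sum_any (\<lambda>q. Poly_Mapping.lookup (Poly_Mapping.single ?x (1::'k)) q when \<mu> + ?x = l + q)
      = (1 when l = \<mu>)" for l
  proof -
    have "(Poly_Mapping.lookup (Poly_Mapping.single ?x (1::'k)) q when \<mu> + ?x = l + q)
        = ((1 when l = \<mu>) when q = ?x)" for q
      by (auto simp: lookup_single when_def)
    then show ?thesis by simp
  qed
  then show ?thesis
    by (simp add: lookup_mult indet_def mult_when)
qed

text \<open>Every monomial of \<open>p * indet x\<close> has positive exponent at \<open>x\<close>,
  whereas the given one has exponent \<open>0\<close> there.\<close>

lemma lookup_mult_indet_other:
  assumes "x \<noteq> y" "Poly_Mapping.lookup \<mu> x = 0"
  shows "Poly_Mapping.lookup (p * indet x) (\<mu> + Poly_Mapping.single y 1) = 0"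
proof (rule ccontr)
  assume "\<not> ?thesis"
  then have "\<mu> + Poly_Mapping.single y 1 \<in> Poly_Mapping.keys (p * indet x)"
    by (simp add: in_keys_iff)
  then obtain \<nu> where "\<mu> + Poly_Mapping.single y 1 = \<nu> + Poly_Mapping.single x 1"
    using keys_mult[of p "indet x"] by (fastforce simp: indet_def split: if_splits)
  then have "Poly_Mapping.lookup (\<mu> + Poly_Mapping.single y 1) x =
      Poly_Mapping.lookup (\<nu> + Poly_Mapping.single x 1) x"
    by simp
  then show False
    using assms by (auto simp: lookup_add lookup_single when_def split: if_splits)
qed

text \<open>As \<mu> contains no entry of the third matrix, only the summand belonging to
  \<open>VD q l\<close> can contribute to this monomial.\<close>

lemma lookup_sum_mult_indet_VD:
  fixes P :: "nat \<Rightarrow> nat \<Rightarrow> 'k::comm_ring_1 mpoly"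
  assumes "l < n" "q < n" "\<And>q l. Poly_Mapping.lookup \<mu> (VD q l) = 0"
  shows "Poly_Mapping.lookup (\<Sum>l<n. \<Sum>q<n. P l q * indet (VD q l)) (\<mu> + Poly_Mapping.single (VD q l) 1)
    = Poly_Mapping.lookup (P l q) \<mu>"
proof -
  have "Poly_Mapping.lookup (P l' q' * indet (VD q' l')) (\<mu> + Poly_Mapping.single (VD q l) 1) =
    (if l' = l then if q' = q then Poly_Mapping.lookup (P l q) \<mu> else 0 else 0)" for l' q'
    using lookup_mult_indet[of "P l q" "VD q l" \<mu>]
      lookup_mult_indet_other[of "VD q' l'" "VD q l" \<mu> "P l' q'"] assms(3)
    by auto
  then have "Poly_Mapping.lookup (\<Sum>l<n. \<Sum>q<n. P l q * indet (VD q l)) (\<mu> + Poly_Mapping.single (VD q l) 1)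
    = (\<Sum>l'<n. \<Sum>q'<n. if l' = l then if q' = q then Poly_Mapping.lookup (P l q) \<mu> else 0 else 0)"
    by (simp add: lookup_sum)
  also have "\<dots> = (\<Sum>l'<n. if l' = l
      then \<Sum>q'<n. if q' = q then Poly_Mapping.lookup (P l q) \<mu> else 0 else 0)"
    by (intro sum.cong) auto
  also have "\<dots> = Poly_Mapping.lookup (P l q) \<mu>"
    using assms(1,2) by simp
  finally show ?thesis .
qed

lemma coefficients_of_VD_unique:
  fixes P Q :: "nat \<Rightarrow> nat \<Rightarrow> 'k::comm_ring_1 mpoly"
  assumes "(\<Sum>l<n. \<Sum>q<n. P l q * indet (VD q l)) = (\<Sum>l<n. \<Sum>q<n. Q l q * indet (VD q l))"
    and "\<And>l q. D_free (P l q)" "\<And>l q. D_free (Q l q)" "l < n" "q < n"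
  shows "P l q = Q l q"
proof (rule poly_mapping_eqI)
  fix \<mu>
  show "Poly_Mapping.lookup (P l q) \<mu> = Poly_Mapping.lookup (Q l q) \<mu>"
  \<comment> \<open>A monomial without entries of the third matrix is tested after multiplication by
    \<open>VD q l\<close>; any other monomial has coefficient \<open>0\<close> on both
    sides.\<close>
  proof (cases "\<forall>q l. Poly_Mapping.lookup \<mu> (VD q l) = 0")
    case True
    then show ?thesis
      using lookup_sum_mult_indet_VD[where P = P and \<mu> = \<mu>, OF assms(4,5)]
        lookup_sum_mult_indet_VD[where P = Q and \<mu> = \<mu>, OF assms(4,5)] assms(1) by simp
  next
    case False
    then have "\<mu> \<notin> Poly_Mapping.keys (P l q)" "\<mu> \<notin> Poly_Mapping.keys (Q l q)"
      using assms(2,3) unfolding D_free_def by blast+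
    then show ?thesis by (simp add: in_keys_iff)
  qed
qed

lemma trilinear_identity_imp_elementary_program:
  fixes u v w :: "nat \<Rightarrow> nat \<Rightarrow> nat \<Rightarrow> 'k::comm_ring_1"
  assumes "trilinear_identity n R u v w"
  shows "elementary_program n R u v w"
proof -
  \<comment> \<open>\<open>P l q\<close> and \<open>Q l q\<close> are the coefficients of
    \<open>VD q l\<close> on the two sides of the trilinear identity: the entry of the matrix
    product and the value the program computes for it.\<close>
  define P :: "nat \<Rightarrow> nat \<Rightarrow> 'k mpoly"
    where "P l q = (\<Sum>g<n. indet (VA l g) * indet (VB g q))" for l q
  define Q :: "nat \<Rightarrow> nat \<Rightarrow> 'k mpoly"
    where "Q l q = (\<Sum>s=1..R. scalar (w s l q) * formA n (u s) * formB n (v s))" for l q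
  have "(\<Sum>l<n. \<Sum>q<n. P l q * indet (VD q l)) =
      (\<Sum>l<n. \<Sum>g<n. \<Sum>q<n. indet (VA l g) * indet (VB g q) * indet (VD q l))"
    unfolding P_def sum_distrib_right by (intro sum.cong refl sum.swap)
  also have "\<dots> = (\<Sum>s=1..R. formA n (u s) * formB n (v s) * formD n (w s))"
    using assms by (simp add: trilinear_identity_def)
  \<comment> \<open>The transposed convention of \<open>formD\<close> puts \<open>w s l q\<close> in
    front of exactly \<open>VD q l\<close>.\<close>
  also have "\<dots> = (\<Sum>s=1..R. \<Sum>l<n. \<Sum>q<n.
      scalar (w s l q) * formA n (u s) * formB n (v s) * indet (VD q l))"
    unfolding formD_def sum_distrib_left by (intro sum.cong) (simp_all add: ac_simps)
  also have "\<dots> = (\<Sum>l<n. \<Sum>s=1..R. \<Sum>q<n.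
      scalar (w s l q) * formA n (u s) * formB n (v s) * indet (VD q l))"
    by (rule sum.swap)
  also have "\<dots> = (\<Sum>l<n. \<Sum>q<n. Q l q * indet (VD q l))"
    unfolding Q_def sum_distrib_right by (intro sum.cong refl sum.swap)
  finally have "(\<Sum>l<n. \<Sum>q<n. P l q * indet (VD q l)) = (\<Sum>l<n. \<Sum>q<n. Q l q * indet (VD q l))" .
  moreover have "D_free (P l q)" "D_free (Q l q)" for l q
    by (simp_all add: P_def Q_def D_free_sum D_free_mult D_free_scalar D_free_indet
        D_free_formA D_free_formB)
  ultimately show ?thesis
    using coefficients_of_VD_unique[where P = P and Q = Q]
    unfolding elementary_program_def P_def Q_def by blast
qed

text \<open>Linearity of every factor provides its coefficients, and choosing them for each summand
  yields the three families. List positions start at \<open>0\<close> but multiplications at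
  \<open>1\<close>, hence the shift by one.\<close>

lemma ex_defines_program:
  fixes ts :: "('k::comm_ring_1 mpoly \<times> 'k mpoly \<times> 'k mpoly) list"
  assumes lin: "\<And>x y z. (x, y, z) \<in> set ts \<Longrightarrow>
      linear_form n VA x \<and> linear_form n VB y \<and> linear_form n VD z"
    and sum: "(\<Sum>(x, y, z)\<leftarrow>ts. x * y * z) =
      (\<Sum>i<n. \<Sum>j<n. \<Sum>h<n. indet (VA i j) * indet (VB j h) * indet (VD h i))"
  shows "\<exists>u v w. defines_program n ts (length ts) u v w"
proof -
  have "\<forall>s\<in>{1..length ts}. \<exists>u v w. ts ! (s - 1) = (formA n u, formB n v, formD n w)"
  proof
    fix s assume "s \<in> {1..length ts}"
    moreover obtain x y z where t: "ts ! (s - 1) = (x, y, z)"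
      by (cases "ts ! (s - 1)")
    ultimately have "(x, y, z) \<in> set ts"
      by (metis One_nat_def Suc_le_eq Suc_pred atLeastAtMost_iff nth_mem)
    then show "\<exists>u v w. ts ! (s - 1) = (formA n u, formB n v, formD n w)"
      using lin[of x y z] linear_form_formD[of n z]
      unfolding t linear_form_formA linear_form_formB by auto
  qed
  then obtain u v w where
    uvw: "\<And>s. s \<in> {1..length ts} \<Longrightarrow> ts ! (s - 1) = (formA n (u s), formB n (v s), formD n (w s))"
    by metis
  have "(\<Sum>(x, y, z)\<leftarrow>ts. x * y * z) = (\<Sum>s<length ts. case ts ! s of (x, y, z) \<Rightarrow> x * y * z)"
    by (simp add: sum_list_sum_nth atLeast0LessThan)
  also have "\<dots> = (\<Sum>s=1..length ts. case ts ! (s - 1) of (x, y, z) \<Rightarrow> x * y * z)"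
    by (rule sum.reindex_bij_witness[of _ "\<lambda>s. s - 1" Suc]) auto
  also have "\<dots> = (\<Sum>s=1..length ts. formA n (u s) * formB n (v s) * formD n (w s))"
    by (rule sum.cong) (simp_all only: uvw prod.case)
  finally have "trilinear_identity n (length ts) u v w"
    using sum by (simp add: trilinear_identity_def)
  then show ?thesis
    unfolding defines_program_def
    using uvw trilinear_identity_imp_elementary_program by blast
qed

subsection \<open>The aggregation program\<close>

text \<open>The function \<open>f\<close> is left general to serve twice: as the product of the
  three factors for the identity, and as the constant \<open>1\<close> for the length.\<close>

lemma sum_list_aggregation_terms:
  fixes f :: "_ \<Rightarrow> 'a::comm_monoid_add"
  shows "(\<Sum>t\<leftarrow>aggregation_terms n a b d. f t) =
    (\<Sum>(i, j, h)\<in>even_triples n.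
       f (a i j + a (h+1) (i+1), b j h + b (i+1) (j+1), d h i + d (j+1) (h+1)))
    + (\<Sum>i<n. \<Sum>h<n.
         f (- a (h+1) (i+1), \<Sum>j | j < n \<and> even (i + j + h). b j h + b (i+1) (j+1), d h i))
    + (\<Sum>i<n. \<Sum>j<n.
         f (- a i j, b (i+1) (j+1), \<Sum>h | h < n \<and> even (i + j + h). d h i + d (j+1) (h+1)))
    + (\<Sum>h<n. \<Sum>j<n.
         f (- (\<Sum>i | i < n \<and> even (i + j + h). a i j + a (h+1) (i+1)), b j h, d (j+1) (h+1)))"
proof -
  have concat: "(\<Sum>t\<leftarrow>concat xss. f t) = (\<Sum>xs\<leftarrow>xss. \<Sum>t\<leftarrow>xs. f t)" for xss
    by (induction xss) auto
  have upt: "(\<Sum>i\<leftarrow>[0..<n]. g i) = (\<Sum>i<n. g i)" for g :: "nat \<Rightarrow> 'a"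
    by (simp add: interv_sum_list_conv_sum_set_nat atLeast0LessThan)
  have cond: "(\<Sum>t\<leftarrow>(if P then [x] else []). f t) = (if P then f x else 0)" for P x
    by simp
  show ?thesis
    unfolding aggregation_terms_def sum_even_triples map_append sum_list_append concat map_map
      comp_def cond upt add.assoc by simp
qed

text \<open>Half of the \<open>n ^ 3\<close> triples are even, and each of the three correction
  families has \<open>n ^ 2\<close> members.\<close>

lemma length_aggregation_terms:
  assumes "even n"
  shows "real (length (aggregation_terms n a b d)) = 0.5 * real n ^ 3 + 3 * real n ^ 2"
proof -
  have "length (aggregation_terms n a b d) = (\<Sum>t\<leftarrow>aggregation_terms n a b d. 1)"
    by (simp add: sum_list_triv)
  then have "length (aggregation_terms n a b d) = card (even_triples n) + 3 * n ^ 2"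
    by (simp add: sum_list_aggregation_terms case_prod_unfold power2_eq_square)
  moreover have "real (2 * card (even_triples n)) = real (n ^ 3)"
    using two_card_even_triples[OF assms] by simp
  ultimately show ?thesis by simp
qed

lemma linear_form_aggregation_terms:
  assumes "n > 0" "extended_indets n VA a" "extended_indets n VB b" "extended_indets n VD d"
    and "(x, y, z) \<in> set (aggregation_terms n a b d)"
  shows "linear_form n VA x \<and> linear_form n VB y \<and> linear_form n VD z"
proof -
  note lin = linear_form_extended_indets[OF assms(2) _ _ assms(1)]
    linear_form_extended_indets[OF assms(3) _ _ assms(1)]
    linear_form_extended_indets[OF assms(4) _ _ assms(1)]
  have "\<forall>(x, y, z)\<in>set (aggregation_terms n a b d).
      linear_form n VA x \<and> linear_form n VB y \<and> linear_form n VD z"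
    unfolding aggregation_terms_def set_append set_concat set_map ball_Un
    by (simp add: Suc_le_eq lin linear_form_add linear_form_uminus)
      (intro conjI ballI linear_form_uminus linear_form_sum linear_form_add lin; simp)
  then show ?thesis
    using assms(5) by auto
qed

theorem mainTheorem3:
  fixes m n :: nat
    and a b d :: "nat \<Rightarrow> nat \<Rightarrow> 'k::comm_ring_1 mpoly"
  assumes "m > 0" and "n = 2 * m"
    and "extended_indets n VA a" and "extended_indets n VB b" and "extended_indets n VD d"
  shows "(\<Sum>(i, j, h) | i < n \<and> j < n \<and> h < n \<and> even (i + j + h).
            (a i j + a (h+1) (i+1)) * (b j h + b (i+1) (j+1)) * (d h i + d (j+1) (h+1)))
         - (\<Sum>i<n. \<Sum>h<n. a (h+1) (i+1)
              * (\<Sum>j | j < n \<and> even (i + j + h). b j h + b (i+1) (j+1)) * d h i)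
         - (\<Sum>i<n. \<Sum>j<n. a i j * b (i+1) (j+1)
              * (\<Sum>h | h < n \<and> even (i + j + h). d h i + d (j+1) (h+1)))
         - (\<Sum>h<n. \<Sum>j<n. (\<Sum>i | i < n \<and> even (i + j + h). a i j + a (h+1) (i+1))
              * b j h * d (j+1) (h+1))
         = (\<Sum>i<n. \<Sum>j<n. \<Sum>h<n. a i j * b j h * d h i)
       \<and> (\<exists>R u v w. defines_program n (aggregation_terms n a b d) R u v w
            \<and> real R = 0.5 * real n ^ 3 + 3 * real n ^ 2)"
proof -
  have "even n" "n > 0"
    using assms(1,2) by auto
  note identity = aggregation_identity[where a = a and b = b and d = d, OF \<open>even n\<close> extended_indets_Suc[OF assms(3)]
      extended_indets_Suc[OF assms(4)] extended_indets_Suc[OF assms(5)]]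
  have "(\<Sum>(x, y, z)\<leftarrow>aggregation_terms n a b d. x * y * z) =
      (\<Sum>i<n. \<Sum>j<n. \<Sum>h<n. a i j * b j h * d h i)"
    \<comment> \<open>The signs carried by the first factors turn into the three subtractions of the
      identity.\<close>
    unfolding sum_list_aggregation_terms using identity
    by (simp add: sum_negf case_prod_unfold)
  also have "\<dots> = (\<Sum>i<n. \<Sum>j<n. \<Sum>h<n. indet (VA i j) * indet (VB j h) * indet (VD h i))"
    using assms(3-5) by (intro sum.cong refl) (auto simp: extended_indets_def)
  finally have "\<exists>u v w. defines_program n (aggregation_terms n a b d)
      (length (aggregation_terms n a b d)) u v w"
    by (intro ex_defines_program linear_form_aggregation_terms[OF \<open>n > 0\<close> assms(3-5)])
  then show ?thesis
    \<comment> \<open>The witness for \<open>R\<close> is the number of summands.\<close>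
    using length_aggregation_terms[OF \<open>even n\<close>, of a b d]
    by (intro conjI identity[unfolded even_triples_def]) auto
qed

end
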